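(* Let $\mathscr{H}$ be a complex Hilbert space, let $A, B, X \in \mathbb{B}(\mathscr{H})$ with $A$ strictly positive, and let $M=\begin{pmatrix}A & X \\ X^* & B\end{pmatrix}\in\mathbb{B}(\mathscr{H}\oplus\mathscr{H})$. Then $M$ is positive if and only if $B\geq X^*A^{-1}X$.
   Context: $\mathbb{B}(\mathscr{H})$ denotes the algebra of bounded linear operators on $\mathscr{H}$. An operator $T$ is positive ($T\ge 0$) if $\langle Tx,x\rangle\ge 0$ for all $x$; it is strictly positive ($T>0$) if it is positive and invertible. For self-adjoint $S,T$, $S\le T$ means $T-S\ge 0$; here $B\ge X^*A^{-1}X$ means that $B-X^*A^{-1}X$ is positive (in particular $B$ is self-adjoint). *)

theory Defs
  imports "HOL-Analysis.Analysis" "HOL-Library.Complex_Order"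
begin

class complex_vector = real_vector +
  fixes scaleC :: "complex \<Rightarrow> 'a \<Rightarrow> 'a"  (infixr \<open>*\<^sub>C\<close> 75)
  assumes scaleC_add_right: "a *\<^sub>C (x + y) = a *\<^sub>C x + a *\<^sub>C y"
    and scaleC_add_left: "(a + b) *\<^sub>C x = a *\<^sub>C x + b *\<^sub>C x"
    and scaleC_scaleC: "a *\<^sub>C b *\<^sub>C x = (a * b) *\<^sub>C x"
    and scaleC_one: "1 *\<^sub>C x = x"
    and scaleR_scaleC: "r *\<^sub>R x = complex_of_real r *\<^sub>C x"

text \<open>
  The complex inner product is linear in its first argument. The real inner product inherited from
  \<^class>\<open>real_inner\<close> is required to be its real part; the axioms of that class then yield positive
  definiteness of the complex inner product and the norm \<open>norm x = sqrt (Re (cinner x x))\<close>.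
\<close>

class complex_inner = complex_vector + real_inner +
  fixes cinner :: "'a \<Rightarrow> 'a \<Rightarrow> complex"
  assumes cinner_commute: "cinner x y = cnj (cinner y x)"
    and cinner_add_left: "cinner (x + y) z = cinner x z + cinner y z"
    and cinner_scaleC_left: "cinner (a *\<^sub>C x) y = a * cinner x y"
    and inner_eq_Re_cinner: "inner x y = Re (cinner x y)"

class complex_hilbert_space = complex_inner + complete_space

instantiation complex :: complex_hilbert_space
begin

definition "a *\<^sub>C (x :: complex) = a * x"

definition "cinner (x :: complex) y = x * cnj y"

instance
  by standard
    (simp_all add: scaleC_complex_def cinner_complex_def algebra_simps scaleR_conv_of_real
      inner_complex_def)

end

text \<open>The Hilbert space direct sum \<open>H \<oplus> K\<close> is the product type.\<close>

instantiation prod :: (complex_hilbert_space, complex_hilbert_space) complex_hilbert_space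
begin

definition "a *\<^sub>C (x :: 'a \<times> 'b) = (a *\<^sub>C fst x, a *\<^sub>C snd x)"

definition "cinner (x :: 'a \<times> 'b) y = cinner (fst x) (fst y) + cinner (snd x) (snd y)"

instance
proof
  fix x y :: "'a \<times> 'b"
  show "cinner x y = cnj (cinner y x)"
    unfolding cinner_prod_def by (metis cinner_commute complex_cnj_add)
qed (simp_all add: scaleC_prod_def cinner_prod_def scaleC_add_right scaleC_add_left scaleC_scaleC
    scaleC_one scaleR_scaleC prod_eq_iff cinner_add_left cinner_scaleC_left inner_prod_def
    inner_eq_Re_cinner algebra_simps)

end

definition bounded_clinear :: "('a::complex_inner \<Rightarrow> 'b::complex_inner) \<Rightarrow> bool" where
  "bounded_clinear T \<longleftrightarrow> bounded_linear T \<and> (\<forall>c x. T (c *\<^sub>C x) = c *\<^sub>C T x)"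

text \<open>
  The defining equation determines the adjoint uniquely; for bounded operators between Hilbert
  spaces it exists by the Riesz representation theorem.
\<close>

definition cadjoint :: "('a::complex_inner \<Rightarrow> 'b::complex_inner) \<Rightarrow> 'b \<Rightarrow> 'a" where
  "cadjoint T = (THE S. \<forall>x y. cinner (T x) y = cinner x (S y))"

text \<open>
  The order on \<^typ>\<open>complex\<close> is the one for which \<open>0 \<le> z\<close> means that \<open>z\<close> is real and nonnegative.
\<close>

definition positive_op :: "('a::complex_inner \<Rightarrow> 'a) \<Rightarrow> bool" where
  "positive_op T \<longleftrightarrow> bounded_clinear T \<and> (\<forall>x. 0 \<le> cinner (T x) x)"

definition invertible_op :: "('a::complex_inner \<Rightarrow> 'a) \<Rightarrow> bool" where
  "invertible_op T \<longleftrightarrow> (\<exists>S. bounded_clinear S \<and> S \<circ> T = id \<and> T \<circ> S = id)"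

definition strictly_positive_op :: "('a::complex_inner \<Rightarrow> 'a) \<Rightarrow> bool" where
  "strictly_positive_op T \<longleftrightarrow> positive_op T \<and> invertible_op T"

text \<open>Self-adjointness of \<open>S\<close> and \<open>T\<close> is not demanded separately, only positivity of \<open>T - S\<close>.\<close>

definition op_le :: "('a::complex_inner \<Rightarrow> 'a) \<Rightarrow> ('a \<Rightarrow> 'a) \<Rightarrow> bool" where
  "op_le S T \<longleftrightarrow> positive_op (\<lambda>x. T x - S x)"

definition block_op ::
  "('a \<Rightarrow> 'c) \<Rightarrow> ('b \<Rightarrow> 'c) \<Rightarrow> ('a \<Rightarrow> 'd) \<Rightarrow> ('b \<Rightarrow> 'd) \<Rightarrow>
    'a \<times> 'b \<Rightarrow> 'c::complex_inner \<times> 'd::complex_inner" where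
  "block_op P Q R S = (\<lambda>(x, y). (P x + Q y, R x + S y))"

end

(*
  The block form is diagonalised by completing the square. With C the inverse of A,
    <M (x, y), (x, y)> = <A z, z> + <(B - X* C X) y, y>   where z = x + C X y.
  Both summands are nonnegative if B \<ge> X* C X; conversely x = - C X y makes z vanish. The adjoint
  of X comes from the Riesz representation theorem, where the representing vector of a functional f
  is the minimiser of the energy |y|^2 - 2 f y.
*)

theory Submission
  imports Defs
begin

section \<open>Riesz representation\<close>

text \<open>Stated for real functionals only: a complex functional is determined by its real part,
  and \<open>cadjoint_exists\<close> recovers the imaginary part.\<close>

lemma riesz_representation:
  fixes f :: "'a::{real_inner, complete_space} \<Rightarrow> real"
  assumes "bounded_linear f"
  obtains s where "\<And>x. f x = inner x s"
proof -
  interpret f: bounded_linear f by fact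
  \<comment> \<open>If f is the inner product with s, then J y = |y - s|^2 - |s|^2, so a minimiser
    of J is the only candidate for s.\<close>
  define J where "J y = (norm y)\<^sup>2 - 2 * f y" for y
  define d where "d = Inf (range J)"
  obtain K where K: "\<And>x. norm (f x) \<le> norm x * K"
    using f.bounded by blast
  \<comment> \<open>The bound on f gives J y >= |y|^2 - 2 K |y| = (|y| - K)^2 - K^2.\<close>
  have lower: "- K\<^sup>2 \<le> J y" for y
  proof -
    have "2 * f y \<le> 2 * (norm y * K)"
      using K[of y] by simp
    moreover have "0 \<le> (norm y - K)\<^sup>2"
      by simp
    ultimately show ?thesis
      by (simp add: J_def power2_diff)
  qed
  have bdd: "bdd_below (range J)"
    using lower by (auto intro!: bdd_belowI)
  have d_le: "d \<le> J y" for y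
    unfolding d_def by (rule cInf_lower[OF _ bdd]) simp
  have "\<exists>y. J y < d + 1 / real (Suc n)" for n
  proof -
    have "Inf (range J) < d + 1 / real (Suc n)"
      by (simp add: d_def)
    then show ?thesis
      by (subst (asm) cInf_less_iff[OF _ bdd]) auto
  qed
  then obtain y where y: "\<And>n. J (y n) < d + 1 / real (Suc n)"
    by metis
  \<comment> \<open>The parallelogram law; the contributions of f cancel because f is
    linear.\<close>
  have parallelogram: "(norm (a - b))\<^sup>2 = 2 * J a + 2 * J b - 4 * J ((1/2) *\<^sub>R (a + b))" for a b
    by (simp add: J_def f.scaleR f.add power2_norm_eq_inner inner_commute algebra_simps)
  have "Cauchy y"
  proof (rule metric_CauchyI)
    fix e :: real assume "e > 0"
    \<comment> \<open>Two values of J below d + e^2/4 and a midpoint value of at least d make the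
      right side of \<open>parallelogram\<close> less than e^2.\<close>
    then obtain N where N: "1 / real (Suc N) < e\<^sup>2 / 4"
      by (metis nat_approx_posE zero_less_power zero_less_divide_iff zero_less_numeral)
    have small: "J (y n) < d + e\<^sup>2 / 4" if "n \<ge> N" for n
    proof -
      have "1 / real (Suc n) \<le> 1 / real (Suc N)"
        using that by (intro divide_left_mono) auto
      with N y[of n] show ?thesis by linarith
    qed
    show "\<exists>M. \<forall>m\<ge>M. \<forall>n\<ge>M. dist (y m) (y n) < e"
    proof (intro exI allI impI)
      fix m n assume "m \<ge> N" "n \<ge> N"
      then have "(norm (y m - y n))\<^sup>2 < e\<^sup>2"
        using small[of m] small[of n] d_le[of "(1/2) *\<^sub>R (y m + y n)"]
        unfolding parallelogram by linarith
      then show "dist (y m) (y n) < e"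
        using \<open>e > 0\<close> by (simp add: dist_norm power_less_imp_less_base)
    qed
  qed
  then obtain s where s: "y \<longlonglongrightarrow> s"
    using Cauchy_convergent convergent_def by blast
  have "(\<lambda>n. J (y n)) \<longlonglongrightarrow> J s"
    unfolding J_def by (intro tendsto_intros s f.tendsto)
  moreover have "(\<lambda>n. d + 1 / real (Suc n)) \<longlonglongrightarrow> d"
    using LIMSEQ_inverse_real_of_nat_add[of d] by (simp add: inverse_eq_divide)
  ultimately have "J s \<le> d"
    by (rule LIMSEQ_le) (use y in \<open>auto intro: less_imp_le\<close>)
  have "f x = inner x s" for x
  proof (cases "x = 0")
    case False
    define c where "c = inner x s - f x"
    define N where "N = inner x x"
    \<comment> \<open>This t minimises the quadratic J s - 2 t c + t^2 N, the value of J at s - t x;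
      its minimum lies c^2 / N below J s, which forces c = 0.\<close>
    define t where "t = c / N"
    have N: "N > 0"
      using False by (simp add: N_def)
    have "J s \<le> J (s - t *\<^sub>R x)"
      using \<open>J s \<le> d\<close> d_le order_trans by blast
    also have "J (s - t *\<^sub>R x) = J s - 2 * t * c + t * (t * N)"
      by (simp add: J_def f.scaleR f.diff power2_norm_eq_inner inner_commute c_def N_def
          algebra_simps)
    also have "t * N = c"
      using N by (simp add: t_def)
    finally have "c\<^sup>2 / N \<le> 0"
      by (simp add: t_def power2_eq_square)
    with N have "c = 0"
      by (simp add: divide_le_0_iff)
    then show ?thesis
      by (simp add: c_def)
  qed (simp add: f.zero)
  then show thesis
    by (rule that)
qed

section \<open>Complex inner products and adjoints\<close>

lemma cinner_add_right: "cinner x (y + z) = cinner x y + cinner x z"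
  by (metis cinner_commute cinner_add_left complex_cnj_add)

lemma cinner_scaleC_right: "cinner x (a *\<^sub>C y) = cnj a * cinner x y"
  by (metis cinner_commute cinner_scaleC_left complex_cnj_mult)

lemma cinner_diff_left: "cinner (x - y) z = cinner x z - cinner y z"
  by (metis add_diff_cancel_right' cinner_add_left diff_add_cancel)

lemma scaleC_diff_right: "a *\<^sub>C (x - y) = a *\<^sub>C x - a *\<^sub>C (y :: 'a::complex_vector)"
  by (metis add_diff_cancel_right' scaleC_add_right diff_add_cancel)

lemma Im_cinner: "Im (cinner x y) = - inner (\<i> *\<^sub>C x) y"
  by (simp add: inner_eq_Re_cinner cinner_scaleC_left)

lemma cinner_ext_right:
  assumes "\<And>x. cinner x y = cinner x z"
  shows "y = z"
  by (metis assms inner_eq_Re_cinner vector_eq_ldot)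

lemma bounded_clinearI:
  assumes "\<And>x y. T (x + y) = T x + T y"
    and scale: "\<And>c x. T (c *\<^sub>C x) = c *\<^sub>C T x"
    and "\<And>x. norm (T x) \<le> norm x * K"
  shows "bounded_clinear T"
  unfolding bounded_clinear_def
  using assms by (auto intro!: bounded_linear_intro simp: scaleR_scaleC)

text \<open>Riesz applied to the real part of x \<mapsto> <T x, y> yields s. Putting i x for x turns
  equality of real parts into equality of imaginary parts, since T commutes with i.\<close>

lemma cadjoint_exists:
  fixes T :: "'a::complex_hilbert_space \<Rightarrow> 'b::complex_inner"
  assumes "bounded_clinear T"
  shows "\<exists>s. \<forall>x. cinner (T x) y = cinner x s"
proof -
  have "bounded_linear T" and T_scale: "\<And>c x. T (c *\<^sub>C x) = c *\<^sub>C T x"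
    using assms by (simp_all add: bounded_clinear_def)
  from bounded_linear_compose[OF bounded_linear_inner_left this(1), of y]
  obtain s where s: "\<And>x. inner (T x) y = inner x s"
    by (rule riesz_representation) blast
  have "cinner (T x) y = cinner x s" for x
  proof (rule complex_eqI)
    show "Re (cinner (T x) y) = Re (cinner x s)"
      using s[of x] by (simp add: inner_eq_Re_cinner)
    show "Im (cinner (T x) y) = Im (cinner x s)"
      using s[of "\<i> *\<^sub>C x"] by (simp add: Im_cinner T_scale)
  qed
  then show ?thesis
    by blast
qed

text \<open>Justifies the definite description in \<open>cadjoint\<close>: existence comes from
  choosing a vector for each y, uniqueness from nondegeneracy of the inner product.\<close>

lemma cinner_cadjoint_right:
  fixes T :: "'a::complex_hilbert_space \<Rightarrow> 'b::complex_inner"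
  assumes "bounded_clinear T"
  shows "cinner x (cadjoint T y) = cinner (T x) y"
proof -
  obtain S where S: "\<forall>x y. cinner (T x) y = cinner x (S y)"
    using cadjoint_exists[OF assms] by metis
  have "\<forall>x y. cinner (T x) y = cinner x (cadjoint T y)"
    unfolding cadjoint_def
  proof (rule theI[of _ S])
    show "\<forall>x y. cinner (T x) y = cinner x (S y)"
      by (rule S)
  next
    fix S' assume "\<forall>x y. cinner (T x) y = cinner x (S' y)"
    with S show "S' = S"
      by (metis cinner_ext_right ext)
  qed
  then show ?thesis
    by simp
qed

lemma cinner_cadjoint_left:
  fixes T :: "'a::complex_hilbert_space \<Rightarrow> 'b::complex_inner"
  assumes "bounded_clinear T"
  shows "cinner (cadjoint T y) x = cinner y (T x)"
  by (metis assms cinner_cadjoint_right cinner_commute)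

lemma bounded_clinear_cadjoint:
  fixes T :: "'a::complex_hilbert_space \<Rightarrow> 'b::complex_inner"
  assumes "bounded_clinear T"
  shows "bounded_clinear (cadjoint T)"
proof -
  note adj = cinner_cadjoint_right[OF assms]
  have "bounded_linear T"
    using assms by (simp add: bounded_clinear_def)
  then obtain K where K: "\<And>x. norm (T x) \<le> norm x * K" and "K \<ge> 0"
    using bounded_linear.nonneg_bounded by blast
  show ?thesis
  proof (rule bounded_clinearI)
    show "cadjoint T (x + y) = cadjoint T x + cadjoint T y" for x y
      by (rule cinner_ext_right) (simp add: adj cinner_add_right)
    show "cadjoint T (c *\<^sub>C x) = c *\<^sub>C cadjoint T x" for c x
      by (rule cinner_ext_right) (simp add: adj cinner_scaleC_right)
    \<comment> \<open>With s the adjoint applied to y, |s|^2 = Re <T s, y> <= K |s| |y|. Cancel |s|;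
      if s = 0, use K >= 0.\<close>
    show "norm (cadjoint T y) \<le> norm y * K" for y
    proof -
      let ?s = "cadjoint T y"
      have "norm ?s * norm ?s = inner (T ?s) y"
        by (metis adj inner_eq_Re_cinner power2_eq_square power2_norm_eq_inner)
      also have "\<dots> \<le> norm (T ?s) * norm y"
        by (rule norm_cauchy_schwarz)
      also have "\<dots> \<le> norm ?s * K * norm y"
        by (intro mult_right_mono K) simp
      finally have "norm ?s * norm ?s \<le> norm ?s * (norm y * K)"
        by (simp add: algebra_simps)
      then show ?thesis
        using \<open>K \<ge> 0\<close> by (cases "norm ?s = 0") (auto simp: mult_le_cancel_left)
    qed
  qed
qed

lemma bounded_clinear_compose:
  "bounded_clinear S \<Longrightarrow> bounded_clinear T \<Longrightarrow> bounded_clinear (S \<circ> T)"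
  by (auto simp: bounded_clinear_def o_def intro: bounded_linear_compose)

lemma bounded_clinear_diff:
  "bounded_clinear S \<Longrightarrow> bounded_clinear T \<Longrightarrow> bounded_clinear (\<lambda>x. S x - T x)"
  by (auto simp: bounded_clinear_def scaleC_diff_right intro: bounded_linear_sub)

lemma bounded_clinear_block_op:
  fixes P :: "'a::complex_hilbert_space \<Rightarrow> 'c::complex_hilbert_space"
    and Q :: "'b::complex_hilbert_space \<Rightarrow> 'c"
    and R :: "'a \<Rightarrow> 'd::complex_hilbert_space" and S :: "'b \<Rightarrow> 'd"
  assumes "bounded_clinear P" "bounded_clinear Q" "bounded_clinear R" "bounded_clinear S"
  shows "bounded_clinear (block_op P Q R S)"
proof -
  have "bounded_linear (\<lambda>z. (P (fst z) + Q (snd z), R (fst z) + S (snd z)))"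
    using assms unfolding bounded_clinear_def
    by (intro bounded_linear_Pair bounded_linear_add)
      (auto intro: bounded_linear_compose bounded_linear_fst bounded_linear_snd)
  then show ?thesis
    using assms
    by (auto simp: bounded_clinear_def block_op_def case_prod_unfold scaleC_prod_def scaleC_add_right)
qed

section \<open>Positive operators\<close>

text \<open>
  Polarisation: the imaginary part of the form vanishes at \<open>x + y\<close> and at \<open>\<i>x + y\<close>.
\<close>

lemma positive_op_selfadjoint:
  assumes "positive_op T"
  shows "cinner (T x) y = cinner x (T y)"
proof -
  have "bounded_linear T" and T_scale: "\<And>c x. T (c *\<^sub>C x) = c *\<^sub>C T x"
    and real: "\<And>x. Im (cinner (T x) x) = 0"
    using assms by (auto simp: positive_op_def bounded_clinear_def less_eq_complex_def)
  then interpret T: bounded_linear T by simp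
  have sum: "Im (cinner (T u) v) + Im (cinner (T v) u) = 0" for u v
    using real[of "u + v"] real[of u] real[of v]
    by (simp add: T.add cinner_add_left cinner_add_right)
  have "Re (cinner (T x) y) = Re (cinner (T y) x)"
    using sum[of "\<i> *\<^sub>C x" y] by (simp add: T_scale cinner_scaleC_left cinner_scaleC_right)
  moreover have "Im (cinner (T x) y) = - Im (cinner (T y) x)"
    using sum[of x y] by simp
  ultimately show ?thesis
    by (simp add: cinner_commute[of x "T y"] complex_eq_iff)
qed

text \<open>Identifies the bounded inverse provided by \<open>invertible_op\<close> with the
  function \<open>inv T\<close> that occurs in the theorem.\<close>

lemma invertible_op_inv:
  assumes "invertible_op T"
  shows "bounded_clinear (inv T)" "T (inv T x) = x"
proof -
  obtain S where S: "bounded_clinear S" "S \<circ> T = id" "T \<circ> S = id"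
    using assms by (auto simp: invertible_op_def)
  then have "inv T = S"
    by (simp add: inv_unique_comp)
  with S show "bounded_clinear (inv T)" "T (inv T x) = x"
    by (simp_all add: pointfree_idE)
qed

lemma cinner_block_op_complete_square:
  fixes A B X :: "'a::complex_hilbert_space \<Rightarrow> 'a"
  assumes "bounded_clinear X" and "strictly_positive_op A"
  shows "cinner (block_op A X (cadjoint X) B (x, y)) (x, y) =
    cinner (A (x + inv A (X y))) (x + inv A (X y)) +
    cinner (B y - (cadjoint X \<circ> inv A \<circ> X) y) y"
proof -
  define w where "w = inv A (X y)"
  have pos: "positive_op A" and Aw: "A w = X y"
    using assms(2) by (auto simp: strictly_positive_op_def w_def invertible_op_inv)
  have A_add: "A (x + w) = A x + X y"
    using pos Aw by (simp add: positive_op_def bounded_clinear_def linear_add bounded_linear.linear)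
  \<comment> \<open>Self-adjointness of A with A w = X y. The first equation matches the cross
    terms; the second makes <A w, w> cancel the subtracted term <X* w, y> = <w, X y>.\<close>
  have "cinner (A x) w = cinner x (X y)" and "cinner w (X y) = cinner (X y) w"
    using positive_op_selfadjoint[OF pos, of x w] positive_op_selfadjoint[OF pos, of w w]
    by (simp_all add: Aw)
  then show ?thesis
    by (simp add: block_op_def cinner_prod_def cinner_add_left cinner_add_right cinner_diff_left
        A_add cinner_cadjoint_left[OF assms(1)] flip: w_def)
qed

theorem theorem5p1:
  fixes A B X :: "'a::complex_hilbert_space \<Rightarrow> 'a"
  assumes "bounded_clinear A" and "bounded_clinear B" and "bounded_clinear X"
    and "strictly_positive_op A"
  shows "positive_op (block_op A X (cadjoint X) B) \<longleftrightarrow> op_le (cadjoint X \<circ> inv A \<circ> X) B"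
proof -
  note square = cinner_block_op_complete_square[OF assms(3,4)]
  let ?D = "\<lambda>y. B y - (cadjoint X \<circ> inv A \<circ> X) y"
  have pos: "positive_op A" and inv: "invertible_op A"
    using assms(4) by (simp_all add: strictly_positive_op_def)
  \<comment> \<open>Both operators are bounded and complex linear in any case, so the equivalence
    reduces to one between quadratic forms.\<close>
  have "bounded_clinear (block_op A X (cadjoint X) B)"
    by (intro bounded_clinear_block_op bounded_clinear_cadjoint assms)
  moreover have "bounded_clinear ?D"
    by (intro bounded_clinear_diff bounded_clinear_compose bounded_clinear_cadjoint
        invertible_op_inv inv assms)
  moreover have "(\<forall>z. 0 \<le> cinner (block_op A X (cadjoint X) B z) z) \<longleftrightarrow>
    (\<forall>y. 0 \<le> cinner (?D y) y)"
  proof (intro iffI allI)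
    fix y assume *: "\<forall>z. 0 \<le> cinner (block_op A X (cadjoint X) B z) z"
    have "A 0 = 0"
      using assms(1) by (simp add: bounded_clinear_def linear_0 bounded_linear.linear)
    moreover have "cinner (0 :: 'a) 0 = 0"
      using cinner_diff_left[of "0 :: 'a" 0 0] by simp
    ultimately show "0 \<le> cinner (?D y) y"
      using *[rule_format, of "(- inv A (X y), y)"] unfolding square by simp
  next
    fix z :: "'a \<times> 'a" assume *: "\<forall>y. 0 \<le> cinner (?D y) y"
    obtain x y where "z = (x, y)"
      by fastforce
    moreover have "0 \<le> cinner (A (x + inv A (X y))) (x + inv A (X y))"
      using pos by (simp add: positive_op_def)
    ultimately show "0 \<le> cinner (block_op A X (cadjoint X) B z) z"
      using * by (simp only: square add_nonneg_nonneg)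
  qed
  ultimately show ?thesis
    by (simp add: positive_op_def op_le_def)
qed

end
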